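(* Let $m,n\ge 1$ be integers and let $a>1$ be a fixed real number. The characteristic polynomial of $\mathcal{A}_n^{(m)}$ is given by $$\chi_{\mathcal{A}_n^{(m)}}(t)=(t-1)(t-mn-2)(t-mn-3)\cdots(t-mn-n)=(t-1)\prod_{i=2}^{n}(t-mn-i).$$
   Context: $\mathcal{A}_n^{(m)}$ denotes the hyperplane arrangement in $\mathbb{R}^n$ given by $\{x_i=0 \mid i\in[n]\}\cup\{x_i=a^kx_j \mid k\in[-m,m],\ 1\le i<j\le n\}$, where $[n]=\{1,\dots,n\}$ and $[-m,m]$ is the set of integers from $-m$ to $m$. The intersection poset $\mathrm{L}(\mathcal{A})$ of an arrangement $\mathcal{A}$ in $\mathbb{R}^n$ is the set of flats (nonempty intersections of some of the hyperplanes, including the empty intersection $\mathbb{R}^n$), ordered by reverse inclusion, with minimum $\hat 0=\mathbb{R}^n$. The characteristic polynomial is $\chi_{\mathcal{A}}(t)=\sum_{x\in \mathrm{L}(\mathcal{A})}\mu(\hat 0,x)\,t^{\dim x}$, where $\mu$ is the Möbius function of $\mathrm{L}(\mathcal{A})$. *)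

theory Defs
  imports "HOL-Analysis.Analysis" "HOL-Computational_Algebra.Polynomial"
begin

(* The Moebius function of the poset given by the relation r; (x, y) \<in> r means x \<le> y.
   It is 0 for incomparable arguments; the remaining guards only serve termination. *)
function moebius :: "'b rel \<Rightarrow> 'b \<Rightarrow> 'b \<Rightarrow> int" where
  "moebius r x y =
    (if Partial_order r \<and> finite (Field r) \<and> (x, y) \<in> r
     then (if x = y then 1 else - (\<Sum>z | (x, z) \<in> r \<and> (z, y) \<in> r \<and> z \<noteq> y. moebius r x z))
     else 0)"
  by pat_completeness auto
termination
proof (relation "Wellfounded.measure (\<lambda>(r, x, y). card {w. (x, w) \<in> r \<and> (w, y) \<in> r})", goal_cases)
  case 1
  show ?case by simp
next
  case (2 r x y z)
  then have po: "trans r" "antisym r" and fin: "finite (Field r)" and xy: "(x, y) \<in> r"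
    and z: "(x, z) \<in> r" "(z, y) \<in> r" "z \<noteq> y"
    by (auto simp: partial_order_on_def preorder_on_def)
  have refl: "(y, y) \<in> r"
    using 2(1) xy unfolding partial_order_on_def preorder_on_def refl_on_def
    by (auto simp: Field_def)
  have "finite {w. (x, w) \<in> r \<and> (w, y) \<in> r}"
    by (rule finite_subset[OF _ fin]) (auto simp: Field_def)
  moreover have "{w. (x, w) \<in> r \<and> (w, z) \<in> r} \<subseteq> {w. (x, w) \<in> r \<and> (w, y) \<in> r}"
    using po(1) z(2) by (auto dest: transD)
  moreover have "y \<notin> {w. (x, w) \<in> r \<and> (w, z) \<in> r}"
    using po(2) z by (auto dest: antisymD)
  ultimately have "{w. (x, w) \<in> r \<and> (w, z) \<in> r} \<subset> {w. (x, w) \<in> r \<and> (w, y) \<in> r}"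
    using xy refl by blast
  then show ?case
    using psubset_card_mono \<open>finite {w. (x, w) \<in> r \<and> (w, y) \<in> r}\<close> by auto
qed

declare moebius.simps [simp del]

(* The empty intersection is UNIV, the whole space. *)
definition flats :: "'a set set \<Rightarrow> 'a set set" where
  "flats \<A> = {X. X \<noteq> {} \<and> (\<exists>\<B>\<subseteq>\<A>. X = \<Inter>\<B>)}"

definition intersection_poset :: "'a set set \<Rightarrow> 'a set rel" where
  "intersection_poset \<A> = {(X, Y). X \<in> flats \<A> \<and> Y \<in> flats \<A> \<and> Y \<subseteq> X}"

lemma Field_intersection_poset: "Field (intersection_poset \<A>) = flats \<A>"
  by (auto simp: intersection_poset_def Field_def)

lemma Partial_order_intersection_poset: "Partial_order (intersection_poset \<A>)"
  unfolding partial_order_on_def preorder_on_def Field_intersection_poset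
  by (auto simp: intersection_poset_def refl_on_def trans_def antisym_def)

lemma finite_flats: "finite \<A> \<Longrightarrow> finite (flats \<A>)"
  by (rule finite_subset[of _ "Inter ` Pow \<A>"]) (auto simp: flats_def)

(* Flats are nonempty, so their affine dimension is nonnegative and nat loses nothing. *)
definition characteristic_polynomial :: "'a::euclidean_space set set \<Rightarrow> int poly" where
  "characteristic_polynomial \<A> =
    (\<Sum>X\<in>flats \<A>. monom (moebius (intersection_poset \<A>) UNIV X) (nat (aff_dim X)))"

(* The coordinates of the n-dimensional space are indexed by an arbitrary finite linearly
   ordered type in place of {1, ..., n}, so n = CARD('n). *)
definition multiplicative_arrangement :: "real \<Rightarrow> nat \<Rightarrow> (real ^ 'n::{finite,linorder}) set set" where
  "multiplicative_arrangement a m =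
    {{x. x $ i = 0} | i. True} \<union>
    {{x. x $ i = a powi k * x $ j} | i j k. k \<in> {- int m..int m} \<and> i < j}"

lemma finite_multiplicative_arrangement:
  "finite (multiplicative_arrangement a m :: (real ^ 'n::{finite,linorder}) set set)"
proof -
  have "multiplicative_arrangement a m \<subseteq>
      range (\<lambda>i::'n. {x. x $ i = 0}) \<union>
      (\<lambda>(i::'n, j::'n, k). {x. x $ i = a powi k * x $ j}) ` (UNIV \<times> UNIV \<times> {- int m..int m})"
    unfolding multiplicative_arrangement_def by (fastforce simp: image_iff)
  then show ?thesis
    by (rule finite_subset) auto
qed

end

theory Submission
  imports Defs "HOL-Library.Real_Mod"
begin

text \<open>
  The number \<open>a\<close> enters only through the multiplicative relations that its powers satisfy, and
  since \<open>a > 1\<close> there are none. A primitive \<open>N\<close>-th root of unity \<open>w\<close> has no relation of exponent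
  less than \<open>N\<close> in absolute value, so for large \<open>N\<close> it cannot be told apart from \<open>a\<close> by the
  finitely many equations in question. This gives a finite field method without finite fields:
  replace \<open>a\<close> by \<open>w\<close> and count points whose coordinates lie in the set of \<open>N + 1\<close> complex numbers
  made of \<open>0\<close> and the \<open>N\<close>-th roots of unity.

  A system of equations \<open>x\<^sub>i = 0\<close> and \<open>x\<^sub>i = w\<^sup>k x\<^sub>j\<close> is solved by elimination. Whether two
  expressions for the same coordinate agree is decided by whether \<open>w\<close> to some exponent is \<open>1\<close>, and
  the finitely many exponents that occur are bounded. Hence the same set of free coordinates
  parametrises the real solutions for \<open>a\<close> and the solutions in roots of unity for \<open>w\<close>
  (\<open>ex_solved_by\<close>). If the former have dimension \<open>d\<close>, there are \<open>(N + 1)\<^sup>d\<close> of the latter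
  (\<open>eventually_card_solutions\<close>).

  Whitney's theorem (\<open>characteristic_polynomial_Whitney\<close>) writes the characteristic polynomial as
  an alternating sum of \<open>t\<^sup>d\<close> over all subsystems, with \<open>d\<close> the dimension of the solution space. At
  \<open>t = N + 1\<close> this becomes an inclusion-exclusion sum, whose value is the number of points that
  satisfy none of the equations (\<open>card_avoiding_all\<close>). Such a point places \<open>n\<close> labelled markers on
  a circle of \<open>N\<close> positions, any two of them more than \<open>m\<close> steps apart. The first marker can be
  put anywhere. After cutting the circle there, the other \<open>n - 1\<close> are separated points in an
  interval, and removing the \<open>m\<close> positions that must stay free between neighbours turns their
  placements into injections into a set of \<open>N - m n - 1\<close> elements (\<open>card_separated\<close>). So there are
  \<open>N (N - m n - 1) \<cdots> (N - m n - (n - 1))\<close> points, which is the claimed product at \<open>t = N + 1\<close>.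
  Two polynomials that agree at infinitely many points are equal.
\<close>

section \<open>Alternating sums and Whitney's theorem\<close>

lemma sum_Pow_alternating:
  assumes "finite S"
  shows "(\<Sum>J\<in>Pow S. (- 1) ^ card J) = (if S = {} then 1 else 0 :: int)"
proof -
  have "(\<Sum>J\<in>Pow S. (- 1) ^ card J) = (\<Prod>s\<in>S. 1 - 1 :: int)"
    using assms by (subst prod_diff_conv_sum) auto
  then show ?thesis
    using assms by (auto simp: power_0_left)
qed

text \<open>
  Inclusion-exclusion: a point contributes the alternating sum over the subsets of the conditions
  that it satisfies, which vanishes unless it satisfies none.
\<close>
lemma card_avoiding_all:
  fixes R :: "'p \<Rightarrow> 'i \<Rightarrow> bool"
  assumes "finite P" "finite I"
  shows "int (card {p\<in>P. \<forall>i\<in>I. \<not> R p i}) =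
    (\<Sum>J\<in>Pow I. (- 1) ^ card J * int (card {p\<in>P. \<forall>i\<in>J. R p i}))"
proof -
  have "(\<Sum>J\<in>Pow I. (- 1) ^ card J * int (card {p\<in>P. \<forall>i\<in>J. R p i}))
      = (\<Sum>J\<in>Pow I. \<Sum>p\<in>P. if \<forall>i\<in>J. R p i then (- 1) ^ card J else 0)"
    using assms(1) by (simp add: sum.If_cases Int_def conj_commute mult.commute)
  also have "\<dots> = (\<Sum>p\<in>P. \<Sum>J\<in>Pow I. if \<forall>i\<in>J. R p i then (- 1) ^ card J else 0)"
    by (rule sum.swap)
  also have "\<dots> = (\<Sum>p\<in>P. \<Sum>J\<in>Pow {i\<in>I. R p i}. (- 1) ^ card J)"
    using assms(2) by (intro sum.cong refl sum.mono_neutral_cong_right) auto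
  also have "\<dots> = (\<Sum>p\<in>P. if \<forall>i\<in>I. \<not> R p i then 1 else 0)"
    using assms(2) by (intro sum.cong refl, subst sum_Pow_alternating) auto
  also have "\<dots> = int (card {p\<in>P. \<forall>i\<in>I. \<not> R p i})"
    using assms(1) by (simp add: sum.If_cases Int_def)
  finally show ?thesis by simp
qed

lemma UNIV_in_flats: "UNIV \<in> flats \<A>"
  by (auto simp: flats_def intro: exI[of _ "{}"])

lemma Inter_in_flats:
  assumes "\<And>i. i \<in> I \<Longrightarrow> c \<in> H i" "J \<subseteq> I"
  shows "(\<Inter>i\<in>J. H i) \<in> flats (H ` I)"
proof -
  have "c \<in> (\<Inter>i\<in>J. H i)" "H ` J \<subseteq> H ` I"
    using assms by blast+
  then show ?thesis
    unfolding flats_def by blast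
qed

text \<open>The recursion of the Moebius function, in terms of flats rather than of the order relation.\<close>
lemma moebius_intersection_poset_eq:
  assumes "finite \<A>" "X \<in> flats \<A>"
  shows "moebius (intersection_poset \<A>) UNIV X =
    (if X = UNIV then 1 else - (\<Sum>Z | Z \<in> flats \<A> \<and> X \<subset> Z. moebius (intersection_poset \<A>) UNIV Z))"
proof -
  have "{z. (UNIV, z) \<in> intersection_poset \<A> \<and> (z, X) \<in> intersection_poset \<A> \<and> z \<noteq> X}
     = {Z. Z \<in> flats \<A> \<and> X \<subset> Z}"
    using assms(2) UNIV_in_flats[of \<A>] unfolding intersection_poset_def by auto
  moreover have "Partial_order (intersection_poset \<A>)" "finite (Field (intersection_poset \<A>))"
      "(UNIV, X) \<in> intersection_poset \<A>"
    using assms UNIV_in_flats[of \<A>] Partial_order_intersection_poset[of \<A>]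
    by (simp_all add: Field_intersection_poset finite_flats) (simp add: intersection_poset_def)
  ultimately show ?thesis
    using moebius.simps[of "intersection_poset \<A>" UNIV X] by (simp only: if_True conj_imp_eq_imp_imp simp_thms eq_commute[of UNIV X])
qed

text \<open>
  The right-hand side satisfies the recursion of the Moebius function: its sum over the flats that
  contain \<open>X\<close> runs over all sets \<open>J\<close> of hyperplanes through \<open>X\<close>, and so it vanishes if \<open>X\<close> is not
  the whole space. The hyperplanes form a family indexed by \<open>I\<close>, which may have repetitions;
  thus it never has to be decided when two equations define the same hyperplane. The common
  point \<open>c\<close> makes every intersection a flat.
\<close>
lemma moebius_eq_alternating_sum:
  fixes H :: "'i \<Rightarrow> 'a set"
  assumes fin: "finite I" and pt: "\<And>i. i \<in> I \<Longrightarrow> c \<in> H i" and proper: "\<And>i. i \<in> I \<Longrightarrow> H i \<noteq> UNIV"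
    and "X \<in> flats (H ` I)"
  shows "moebius (intersection_poset (H ` I)) UNIV X =
    (\<Sum>J | J \<subseteq> I \<and> (\<Inter>i\<in>J. H i) = X. (- 1) ^ card J)"
    (is "?\<mu> X = ?f X")
  using \<open>X \<in> flats (H ` I)\<close>
proof (induction "card {Z \<in> flats (H ` I). X \<subset> Z}" arbitrary: X rule: less_induct)
  case less
  have finF: "finite (flats (H ` I))"
    using fin by (simp add: finite_flats)
  have step: "?\<mu> Z = ?f Z" if "Z \<in> flats (H ` I)" "X \<subset> Z" for Z
  proof (rule less.hyps)
    show "card {Y \<in> flats (H ` I). Z \<subset> Y} < card {Y \<in> flats (H ` I). X \<subset> Y}"
      using that finF by (intro psubset_card_mono) auto
  qed (rule that(1))
  have flat: "(\<Inter>i\<in>J. H i) \<in> flats (H ` I)" if "J \<subseteq> I" for J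
    using pt that by (rule Inter_in_flats)
  show ?case
  proof (cases "X = UNIV")
    case True
    have "J = {}" if "J \<subseteq> I" "(\<Inter>i\<in>J. H i) = UNIV" for J
    proof (rule ccontr)
      assume "J \<noteq> {}"
      then obtain i where "i \<in> J" by blast
      with that(2) have "H i = UNIV" by blast
      with \<open>i \<in> J\<close> that(1) proper show False by blast
    qed
    then have "{J. J \<subseteq> I \<and> (\<Inter>i\<in>J. H i) = X} = {{}}"
      using True by auto
    then show ?thesis
      using True less.prems fin by (simp add: moebius_intersection_poset_eq)
  next
    case False
    let ?IX = "{i\<in>I. X \<subseteq> H i}"
    obtain J where "J \<subseteq> I" "X = (\<Inter>i\<in>J. H i)"
      using less.prems unfolding flats_def by (auto simp: subset_image_iff)
    then have "?IX \<noteq> {}"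
      using False by blast
    then have "0 = (\<Sum>J\<in>Pow ?IX. (- 1) ^ card J :: int)"
      using fin by (subst sum_Pow_alternating) auto
    also have "\<dots> = (\<Sum>Z\<in>{Z \<in> flats (H ` I). X \<subseteq> Z}. \<Sum>J | J \<in> Pow ?IX \<and> (\<Inter>i\<in>J. H i) = Z. (- 1) ^ card J)"
    proof (rule sum.group[where g="\<lambda>J. \<Inter>i\<in>J. H i", symmetric])
      show "(\<lambda>J. \<Inter>i\<in>J. H i) ` Pow ?IX \<subseteq> {Z \<in> flats (H ` I). X \<subseteq> Z}"
      proof (rule image_subsetI)
        fix J assume "J \<in> Pow ?IX"
        then have "J \<subseteq> I" and "X \<subseteq> (\<Inter>i\<in>J. H i)" by blast+
        with flat[of J] show "(\<Inter>i\<in>J. H i) \<in> {Z \<in> flats (H ` I). X \<subseteq> Z}" by simp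
      qed
    qed (use fin finF in simp_all)
    also have "\<dots> = (\<Sum>Z\<in>{Z \<in> flats (H ` I). X \<subseteq> Z}. ?f Z)"
    proof (rule sum.cong[OF refl])
      fix Z assume "Z \<in> {Z \<in> flats (H ` I). X \<subseteq> Z}"
      then have "{J. J \<in> Pow ?IX \<and> (\<Inter>i\<in>J. H i) = Z} = {J. J \<subseteq> I \<and> (\<Inter>i\<in>J. H i) = Z}"
        by blast
      then show "(\<Sum>J | J \<in> Pow ?IX \<and> (\<Inter>i\<in>J. H i) = Z. (- 1) ^ card J) = ?f Z"
        by (simp only:)
    qed
    also have "{Z \<in> flats (H ` I). X \<subseteq> Z} = insert X {Z. Z \<in> flats (H ` I) \<and> X \<subset> Z}"
      using less.prems by auto
    also have "(\<Sum>Z\<in>\<dots>. ?f Z) = ?f X + (\<Sum>Z | Z \<in> flats (H ` I) \<and> X \<subset> Z. ?f Z)"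
      using finF by (intro sum.insert) simp_all
    also have "(\<Sum>Z | Z \<in> flats (H ` I) \<and> X \<subset> Z. ?f Z) = (\<Sum>Z | Z \<in> flats (H ` I) \<and> X \<subset> Z. ?\<mu> Z)"
      by (rule sum.cong) (use step in simp_all)
    also have "\<dots> = - ?\<mu> X"
      using False less.prems fin by (simp add: moebius_intersection_poset_eq)
    finally show ?thesis by simp
  qed
qed

text \<open>Whitney's theorem: the sets of hyperplanes are grouped by their intersection.\<close>
lemma characteristic_polynomial_Whitney:
  fixes H :: "'i \<Rightarrow> 'a::euclidean_space set"
  assumes fin: "finite I" and pt: "\<And>i. i \<in> I \<Longrightarrow> c \<in> H i" and proper: "\<And>i. i \<in> I \<Longrightarrow> H i \<noteq> UNIV"
  shows "characteristic_polynomial (H ` I) =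
    (\<Sum>J\<in>Pow I. monom ((- 1) ^ card J) (nat (aff_dim (\<Inter>i\<in>J. H i))))"
proof -
  have "characteristic_polynomial (H ` I) =
      (\<Sum>X\<in>flats (H ` I). \<Sum>J | J \<in> Pow I \<and> (\<Inter>i\<in>J. H i) = X.
        monom ((- 1) ^ card J) (nat (aff_dim (\<Inter>i\<in>J. H i))))"
    unfolding characteristic_polynomial_def
  proof (rule sum.cong[OF refl])
    fix X assume X: "X \<in> flats (H ` I)"
    have "moebius (intersection_poset (H ` I)) UNIV X =
        (\<Sum>J | J \<subseteq> I \<and> (\<Inter>i\<in>J. H i) = X. (- 1) ^ card J)"
      using fin pt proper X by (rule moebius_eq_alternating_sum)
    then have "monom (moebius (intersection_poset (H ` I)) UNIV X) (nat (aff_dim X)) =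
        (\<Sum>J | J \<subseteq> I \<and> (\<Inter>i\<in>J. H i) = X. monom ((- 1) ^ card J) (nat (aff_dim X)))"
      by (simp only: monom_sum)
    also have "\<dots> = (\<Sum>J | J \<in> Pow I \<and> (\<Inter>i\<in>J. H i) = X.
        monom ((- 1) ^ card J) (nat (aff_dim (\<Inter>i\<in>J. H i))))"
      by (rule sum.cong) auto
    finally show "monom (moebius (intersection_poset (H ` I)) UNIV X) (nat (aff_dim X)) = \<dots>" .
  qed
  also have "\<dots> = (\<Sum>J\<in>Pow I. monom ((- 1) ^ card J) (nat (aff_dim (\<Inter>i\<in>J. H i))))"
  proof (rule sum.group[where g="\<lambda>J. \<Inter>i\<in>J. H i"])
    show "(\<lambda>J. \<Inter>i\<in>J. H i) ` Pow I \<subseteq> flats (H ` I)"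
      by (rule image_subsetI, rule Inter_in_flats[where c=c]) (simp_all add: pt)
  qed (use fin in \<open>simp_all add: finite_flats\<close>)
  finally show ?thesis .
qed

section \<open>Systems of equations between coordinates and their solutions\<close>

datatype 'v equation = Vanish 'v | Ratio 'v 'v int

primrec satisfies :: "'f::field \<Rightarrow> ('v \<Rightarrow> 'f) \<Rightarrow> 'v equation \<Rightarrow> bool" where
  "satisfies w x (Vanish i) \<longleftrightarrow> x i = 0"
| "satisfies w x (Ratio i j k) \<longleftrightarrow> x i = w powi k * x j"

text \<open>
  The shape of a solved system: the coordinates in \<open>F\<close> are free, coordinate \<open>i\<close> is the multiple
  \<open>w powi e i\<close> of the free coordinate \<open>r i\<close>, and \<open>r i \<notin> F\<close> marks a coordinate that has to be \<open>0\<close>.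
\<close>
definition extend :: "'f::field \<Rightarrow> 'v set \<Rightarrow> ('v \<Rightarrow> 'v) \<Rightarrow> ('v \<Rightarrow> int) \<Rightarrow> ('v \<Rightarrow> 'f) \<Rightarrow> 'v \<Rightarrow> 'f" where
  "extend w F r e y = (\<lambda>i. if r i \<in> F then w powi e i * y (r i) else 0)"

definition no_small_torsion :: "int \<Rightarrow> 'f::field \<Rightarrow> bool" where
  "no_small_torsion B w \<longleftrightarrow> w \<noteq> 0 \<and> (\<forall>k. k \<noteq> 0 \<longrightarrow> \<bar>k\<bar> \<le> B \<longrightarrow> w powi k \<noteq> 1)"

text \<open>
  \<open>F\<close>, \<open>r\<close> and \<open>e\<close> must not depend on \<open>w\<close>: this is what allows solutions for different numbers \<open>w\<close>
  to be compared. The complex numbers contain both numbers of interest, \<open>a\<close> and a root of unity.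
\<close>
definition solved_by :: "int \<Rightarrow> 'v equation set \<Rightarrow> 'v set \<Rightarrow> ('v \<Rightarrow> 'v) \<Rightarrow> ('v \<Rightarrow> int) \<Rightarrow> bool" where
  "solved_by B J F r e \<longleftrightarrow> (\<forall>f\<in>F. r f = f \<and> e f = 0) \<and>
    (\<forall>(w::complex) x. no_small_torsion B w \<longrightarrow>
      ((\<forall>c\<in>J. satisfies w x c) \<longleftrightarrow> x = extend w F r e x))"

lemma eq_extend_iff:
  "x = extend w F r e x \<longleftrightarrow> (\<forall>i. x i = (if r i \<in> F then w powi e i * x (r i) else 0))"
  by (simp add: extend_def fun_eq_iff)

lemmas extend_eqD = eq_extend_iff[THEN iffD1, rule_format]

text \<open>Setting a free coordinate to \<open>0\<close> makes all coordinates that depend on it vanish.\<close>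
lemma extend_remove_iff:
  assumes f: "f \<in> F" and idem: "\<forall>f\<in>F. r f = f \<and> e f = 0"
  shows "x = extend w (F - {f}) r e x \<longleftrightarrow> x = extend w F r e x \<and> x f = 0"
proof
  assume L: "x = extend w (F - {f}) r e x"
  have f0: "x f = 0"
  proof -
    have "r f = f" using f idem by simp
    then show ?thesis using extend_eqD[OF L, of f] by simp
  qed
  have "x i = (if r i \<in> F then w powi e i * x (r i) else 0)" for i
    using extend_eqD[OF L, of i] f0 by (cases "r i = f") auto
  then show "x = extend w F r e x \<and> x f = 0"
    unfolding eq_extend_iff using f0 by blast
next
  assume R: "x = extend w F r e x \<and> x f = 0"
  have "x i = (if r i \<in> F - {f} then w powi e i * x (r i) else 0)" for i
    using extend_eqD[OF conjunct1[OF R], of i] conjunct2[OF R] by (cases "r i = f") auto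
  then show "x = extend w (F - {f}) r e x"
    unfolding eq_extend_iff by blast
qed

text \<open>
  Expressing the free coordinate \<open>f\<close> by another free coordinate \<open>g\<close> redirects the coordinates that
  depend on \<open>f\<close> to \<open>g\<close>.
\<close>
lemma extend_merge_iff:
  fixes w :: "'f::field" and d :: int
  assumes f: "f \<in> F" and g: "g \<in> F" and fg: "f \<noteq> g" and idem: "\<forall>f\<in>F. r f = f \<and> e f = 0"
    and w: "w \<noteq> 0"
  defines "r' \<equiv> \<lambda>i. if r i = f then g else r i" and "e' \<equiv> \<lambda>i. if r i = f then e i + d else e i"
  shows "x = extend w (F - {f}) r' e' x \<longleftrightarrow> x = extend w F r e x \<and> x f = w powi d * x g"
proof
  assume L: "x = extend w (F - {f}) r' e' x"
  have xf: "x f = w powi d * x g"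
  proof -
    have "r' f = g" "e' f = d" using f idem by (simp_all add: r'_def e'_def)
    then show ?thesis using extend_eqD[OF L, of f] g fg by simp
  qed
  have "x i = (if r i \<in> F then w powi e i * x (r i) else 0)" for i
    using extend_eqD[OF L, of i] xf f g fg w
    by (cases "r i = f") (auto simp: r'_def e'_def power_int_add mult.assoc)
  then show "x = extend w F r e x \<and> x f = w powi d * x g"
    unfolding eq_extend_iff using xf by blast
next
  assume R: "x = extend w F r e x \<and> x f = w powi d * x g"
  have "x i = (if r' i \<in> F - {f} then w powi e' i * x (r' i) else 0)" for i
    using extend_eqD[OF conjunct1[OF R], of i] conjunct2[OF R] f g fg w
    by (cases "r i = f") (auto simp: r'_def e'_def power_int_add mult.assoc)
  then show "x = extend w (F - {f}) r' e' x"
    unfolding eq_extend_iff by blast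
qed

lemma no_small_torsion_mono: "no_small_torsion C w \<Longrightarrow> B \<le> C \<Longrightarrow> no_small_torsion B w"
  by (auto simp: no_small_torsion_def)

text \<open>
  One step of the elimination. \<open>P\<close> is what the new equation \<open>c\<close> says about the free coordinates,
  once the others have been substituted.
\<close>
lemma solved_by_insert:
  fixes J :: "'v equation set"
  assumes S: "solved_by B J F r e" and C: "B \<le> C"
    and idem': "\<forall>f\<in>F'. r' f = f \<and> e' f = 0"
    and eq: "\<And>(w::complex) x. no_small_torsion C w \<Longrightarrow> x = extend w F r e x \<Longrightarrow>
        satisfies w x c \<longleftrightarrow> P w x"
    and iff: "\<And>(w::complex) x. no_small_torsion C w \<Longrightarrow>
        x = extend w F' r' e' x \<longleftrightarrow> x = extend w F r e x \<and> P w x"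
  shows "solved_by C (insert c J) F' r' e'"
  unfolding solved_by_def
proof (intro conjI allI impI idem')
  fix w :: complex and x
  assume w: "no_small_torsion C w"
  then have "no_small_torsion B w" using C no_small_torsion_mono by blast
  then have "(\<forall>c\<in>J. satisfies w x c) \<longleftrightarrow> x = extend w F r e x"
    using S by (auto simp: solved_by_def)
  then show "(\<forall>c\<in>insert c J. satisfies w x c) \<longleftrightarrow> x = extend w F' r' e' x"
    using eq[OF w, of x] iff[OF w, of x] by (auto simp del: satisfies.simps)
qed

lemma solved_by_insert_trivial:
  assumes S: "solved_by B J F r e"
    and eq: "\<And>(w::complex) x. no_small_torsion B w \<Longrightarrow> x = extend w F r e x \<Longrightarrow> satisfies w x c"
  shows "solved_by B (insert c J) F r e"
proof (rule solved_by_insert[OF S order.refl, where P="\<lambda>w x. True"])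
  show "\<forall>f\<in>F. r f = f \<and> e f = 0"
    using S by (simp add: solved_by_def)
qed (use eq in blast)+

lemma solved_by_insert_remove:
  assumes S: "solved_by B J F r e" and f: "f \<in> F" and C: "B \<le> C"
    and eq: "\<And>(w::complex) x. no_small_torsion C w \<Longrightarrow> x = extend w F r e x \<Longrightarrow> satisfies w x c \<longleftrightarrow> x f = 0"
  shows "solved_by C (insert c J) (F - {f}) r e"
proof -
  have idem: "\<forall>f\<in>F. r f = f \<and> e f = 0"
    using S by (simp add: solved_by_def)
  show ?thesis
    using idem by (intro solved_by_insert[OF S C _ eq] extend_remove_iff[OF f idem]) auto
qed

text \<open>
  Elimination, one equation at a time. The bound \<open>B\<close> grows only when an equation relates two
  coordinates that are multiples of the same free coordinate: then the free coordinate has to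
  vanish unless the two multiples agree, and this must be decided by the exponents alone.
\<close>
lemma ex_solved_by:
  assumes "finite J"
  shows "\<exists>B F r e. solved_by B J F r e"
  using assms
proof induction
  case empty
  have "solved_by 0 {} UNIV (\<lambda>i. i) (\<lambda>i. 0)"
    by (simp add: solved_by_def extend_def)
  then show ?case by blast
next
  case (insert c J)
  then obtain B F r e where S: "solved_by B J F r e" by blast
  then have idem: "\<forall>f\<in>F. r f = f \<and> e f = 0" by (simp add: solved_by_def)
  show ?case
  proof (cases c)
    case (Vanish i)
    show ?thesis
    proof (cases "r i \<in> F")
      case True
      have "solved_by B (insert c J) (F - {r i}) r e"
        using True by (intro solved_by_insert_remove[OF S])
          (auto simp: Vanish no_small_torsion_def dest!: extend_eqD[where i=i])
      then show ?thesis by blast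
    next
      case False
      have "solved_by B (insert c J) F r e"
        using False by (intro solved_by_insert_trivial[OF S])
          (auto simp: Vanish dest!: extend_eqD[where i=i])
      then show ?thesis by blast
    qed
  next
    case (Ratio i j k)
    have val: "satisfies w x c \<longleftrightarrow> (if r i \<in> F then w powi e i * x (r i) else 0)
        = w powi k * (if r j \<in> F then w powi e j * x (r j) else 0)"
      if "x = extend w F r e x" for w :: complex and x
      using extend_eqD[OF that, of i] extend_eqD[OF that, of j] by (simp add: Ratio)
    consider (none) "r i \<notin> F" "r j \<notin> F" | (left) "r i \<in> F" "r j \<notin> F" | (right) "r i \<notin> F" "r j \<in> F"
      | (same) "r i \<in> F" "r j = r i" "e i = k + e j"
      | (cycle) "r i \<in> F" "r j = r i" "e i \<noteq> k + e j"
      | (merge) "r i \<in> F" "r j \<in> F" "r i \<noteq> r j" by metis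
    then show ?thesis
    proof cases
      case none
      have "solved_by B (insert c J) F r e"
        using none by (intro solved_by_insert_trivial[OF S]) (simp add: val)
      then show ?thesis by blast
    next
      case left
      have "solved_by B (insert c J) (F - {r i}) r e"
        using left by (intro solved_by_insert_remove[OF S]) (auto simp: val no_small_torsion_def)
      then show ?thesis by blast
    next
      case right
      have "solved_by B (insert c J) (F - {r j}) r e"
        using right by (intro solved_by_insert_remove[OF S]) (auto simp: val no_small_torsion_def)
      then show ?thesis by blast
    next
      case same
      have "solved_by B (insert c J) F r e"
        using same by (intro solved_by_insert_trivial[OF S])
          (simp add: val no_small_torsion_def power_int_add)
      then show ?thesis by blast
    next
      case cycle
      let ?C = "max B \<bar>k + e j - e i\<bar>"
      have "solved_by ?C (insert c J) (F - {r i}) r e"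
      proof (intro solved_by_insert_remove[OF S cycle(1)])
        fix w :: complex and x
        assume w: "no_small_torsion ?C w" and x: "x = extend w F r e x"
        have w0: "w \<noteq> 0" and "w powi (k + e j - e i) \<noteq> 1"
          using w cycle by (auto simp: no_small_torsion_def)
        then have "w powi (k + e j) \<noteq> w powi e i"
          by (simp add: power_int_diff)
        then show "satisfies w x c \<longleftrightarrow> x (r i) = 0"
          using cycle w0 by (auto simp: val[OF x] power_int_add)
      qed auto
      then show ?thesis by blast
    next
      case merge
      define d where "d = k + e j - e i"
      have "solved_by B (insert c J) (F - {r i}) (\<lambda>l. if r l = r i then r j else r l)
          (\<lambda>l. if r l = r i then e l + d else e l)"
      proof (rule solved_by_insert[OF S order.refl])
        show "\<forall>f\<in>F - {r i}. (if r f = r i then r j else r f) = f \<and> (if r f = r i then e f + d else e f) = 0"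
          using idem by auto
      next
        fix w :: complex and x
        assume w: "no_small_torsion B w" and x: "x = extend w F r e x"
        have "w \<noteq> 0" using w by (simp add: no_small_torsion_def)
        then show "satisfies w x c \<longleftrightarrow> x (r i) = w powi d * x (r j)"
          using merge by (simp add: val[OF x] d_def power_int_add power_int_diff field_simps)
      next
        fix w :: complex and x
        assume w: "no_small_torsion B w"
        then show "x = extend w (F - {r i}) (\<lambda>l. if r l = r i then r j else r l)
          (\<lambda>l. if r l = r i then e l + d else e l) x \<longleftrightarrow> x = extend w F r e x \<and> x (r i) = w powi d * x (r j)"
          using merge idem by (intro extend_merge_iff) (auto simp: no_small_torsion_def)
      qed
      then show ?thesis by blast
    qed
  qed
qed

lemma extend_restrict: "extend w F r e (restrict x F) = extend w F r e x"
  by (simp add: extend_def fun_eq_iff)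

lemma extend_free:
  assumes "\<forall>f\<in>F. r f = f \<and> e f = 0" "f \<in> F"
  shows "extend w F r e y f = y f"
  using assms by (simp add: extend_def)

lemma extend_extend:
  assumes "\<forall>f\<in>F. r f = f \<and> e f = 0"
  shows "extend w F r e (extend w F r e y) = extend w F r e y"
proof
  fix i
  show "extend w F r e (extend w F r e y) i = extend w F r e y i"
    using extend_free[OF assms, of "r i" w y]
    by (simp add: extend_def[of w F r e "extend w F r e y"]) (simp add: extend_def)
qed

text \<open>A solution is determined by its free coordinates, and these can be chosen arbitrarily in \<open>S\<close>.\<close>
lemma card_solutions:
  fixes S :: "'f::field set"
  assumes "finite S" "0 \<in> S" and closed: "\<And>k s. s \<in> S \<Longrightarrow> w powi k * s \<in> S"
    and idem: "\<forall>f\<in>F. r f = f \<and> e f = 0" and "finite F"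
  shows "card {x. range x \<subseteq> S \<and> x = extend w F r e x} = card S ^ card F"
proof -
  have "bij_betw (\<lambda>x. restrict x F) {x. range x \<subseteq> S \<and> x = extend w F r e x} (F \<rightarrow>\<^sub>E S)"
    (is "bij_betw _ ?X _")
  proof (rule bij_betw_byWitness[where f'="extend w F r e"])
    show "\<forall>x\<in>{x. range x \<subseteq> S \<and> x = extend w F r e x}. extend w F r e (restrict x F) = x"
      unfolding extend_restrict by auto
    show "\<forall>y\<in>F \<rightarrow>\<^sub>E S. restrict (extend w F r e y) F = y"
    proof
      fix y assume y: "y \<in> F \<rightarrow>\<^sub>E S"
      have "restrict (extend w F r e y) F = restrict y F"
        using extend_free[OF idem] by (intro restrict_ext)
      with y show "restrict (extend w F r e y) F = y"
        by (simp add: PiE_restrict)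
    qed
    show "(\<lambda>x. restrict x F) ` {x. range x \<subseteq> S \<and> x = extend w F r e x} \<subseteq> F \<rightarrow>\<^sub>E S"
      by auto
    show "extend w F r e ` (F \<rightarrow>\<^sub>E S) \<subseteq> {x. range x \<subseteq> S \<and> x = extend w F r e x}"
    proof (rule image_subsetI)
      fix y assume y: "y \<in> F \<rightarrow>\<^sub>E S"
      then have "range (extend w F r e y) \<subseteq> S"
        using closed \<open>0 \<in> S\<close> by (auto simp: extend_def)
      then show "extend w F r e y \<in> {x. range x \<subseteq> S \<and> x = extend w F r e x}"
        by (simp add: extend_extend[OF idem])
    qed
  qed
  then have "card ?X = card (F \<rightarrow>\<^sub>E S)"
    by (rule bij_betw_same_card)
  then show ?thesis
    using card_funcsetE[OF \<open>finite F\<close>, of S] by simp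
qed

text \<open>
  The solution space is the isomorphic image of the coordinate subspace spanned by the free
  coordinates.
\<close>
lemma aff_dim_solutions:
  fixes a :: real and F :: "'n::finite set"
  assumes idem: "\<forall>f\<in>F. r f = f \<and> e f = 0"
  shows "aff_dim {x :: real ^ 'n. ($) x = extend a F r e (($) x)} = int (card F)"
proof -
  let ?X = "{x :: real ^ 'n. ($) x = extend a F r e (($) x)}"
  let ?Y = "{y :: real ^ 'n. \<forall>i. i \<notin> F \<longrightarrow> y $ i = 0}"
  define T where "T y = (\<chi> i. extend a F r e (($) y) i)" for y :: "real ^ 'n"
  have lin: "linear T"
    by (rule linearI) (auto simp: T_def extend_def vec_eq_iff algebra_simps)
  have subY: "subspace ?Y"
    by (auto simp: subspace_def)
  have T: "($) (T y) = extend a F r e (($) y)" for y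
    by (simp add: T_def fun_eq_iff)
  have TF: "T y $ f = y $ f" if "f \<in> F" for y f
    unfolding T by (rule extend_free[OF idem that])
  have "inj_on T ?Y"
  proof (rule inj_onI)
    fix y z assume "y \<in> ?Y" "z \<in> ?Y" and eq: "T y = T z"
    then have "y $ i = z $ i" for i
      using TF[of i y] TF[of i z] by (cases "i \<in> F") auto
    then show "y = z" by (simp add: vec_eq_iff)
  qed
  then have "dim (T ` ?Y) = dim ?Y"
    using subY lin by (intro dim_image_eq) (auto simp: span_eq_iff[THEN iffD2])
  also have "T ` ?Y = ?X"
  proof (intro equalityI subsetI)
    fix x assume "x \<in> T ` ?Y"
    then obtain y where "x = T y" by auto
    then show "x \<in> ?X"
      by (simp add: T extend_extend[OF idem])
  next
    fix x assume x: "x \<in> ?X"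
    define y :: "real ^ 'n" where "y = (\<chi> i. if i \<in> F then x $ i else 0)"
    have "extend a F r e (($) y) = extend a F r e (($) x)"
      by (simp add: extend_def y_def fun_eq_iff)
    then have "($) (T y) = ($) x"
      using x by (simp add: T)
    then have "x = T y"
      by (simp add: vec_eq_iff fun_eq_iff)
    then show "x \<in> T ` ?Y" by (auto simp: y_def)
  qed
  also have "dim ?Y = card F"
    using dim_substandard_cart[where 'a=real, of F] by (simp add: dim_vec_eq)
  finally have "dim ?X = card F" .
  moreover have "subspace ?X"
    using linear_subspace_image[OF lin subY] \<open>T ` ?Y = ?X\<close> by simp
  ultimately show ?thesis by (simp add: aff_dim_subspace)
qed

section \<open>Primitive roots of unity\<close>

text \<open>
  Stated for all integer exponents, so that the exponents of \<open>w\<close> can be treated as elements of a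
  circle with \<open>N\<close> positions.
\<close>
definition primitive_root :: "nat \<Rightarrow> 'f::field \<Rightarrow> bool" where
  "primitive_root N w \<longleftrightarrow> w \<noteq> 0 \<and> (\<forall>k. w powi k = 1 \<longleftrightarrow> int N dvd k)"

lemma ex_primitive_root:
  assumes "0 < N"
  shows "\<exists>w :: complex. primitive_root N w"
proof -
  define w where "w = cis (2 * pi / real N)"
  have "w powi k = 1 \<longleftrightarrow> int N dvd k" for k
  proof -
    have "w powi k = 1 \<longleftrightarrow> (\<exists>n. of_int k * (2 * pi / real N) = of_int n * (2 * pi))"
      by (simp add: w_def cis_power_int cis_eq_1_iff)
    also have "\<dots> \<longleftrightarrow> (\<exists>n. real_of_int k = real_of_int (int N * n))"
      using assms by (simp add: field_simps)
    also have "\<dots> \<longleftrightarrow> int N dvd k"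
      by (simp only: of_int_eq_iff dvd_def)
    finally show ?thesis .
  qed
  moreover have "w \<noteq> 0"
    by (simp add: w_def)
  ultimately show ?thesis
    unfolding primitive_root_def by blast
qed

lemma primitive_root_powi_eq_iff:
  assumes "primitive_root N w"
  shows "w powi k = w powi l \<longleftrightarrow> int N dvd k - l"
proof -
  have "w \<noteq> 0" using assms by (simp add: primitive_root_def)
  then have "w powi k = w powi l \<longleftrightarrow> w powi (k - l) = 1"
    by (simp add: power_int_diff)
  then show ?thesis
    using assms by (simp add: primitive_root_def)
qed

lemma primitive_root_powi_power:
  assumes "primitive_root N w"
  shows "(w powi k) ^ N = 1"
proof -
  have "(w powi k) ^ N = w powi (k * int N)"
    by (simp add: power_int_mult)
  also have "\<dots> = 1"
    using assms by (simp add: primitive_root_def)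
  finally show ?thesis .
qed

lemma roots_of_unity_eq_powi:
  fixes w :: complex
  assumes N: "0 < N" and w: "primitive_root N w"
  shows "{z. z ^ N = 1} = (\<lambda>k. w powi k) ` {0..<int N}"
proof (rule sym, rule card_subset_eq)
  show "finite {z::complex. z ^ N = 1}"
    using N by (intro finite_roots_unity) simp
  show "(\<lambda>k. w powi k) ` {0..<int N} \<subseteq> {z. z ^ N = 1}"
    using primitive_root_powi_power[OF w] by auto
  have "inj_on (\<lambda>k. w powi k) {0..<int N}"
  proof (rule inj_onI)
    fix k l assume "k \<in> {0..<int N}" "l \<in> {0..<int N}" "w powi k = w powi l"
    then show "k = l"
      using primitive_root_powi_eq_iff[OF w, of k l] zdvd_imp_le[of "int N" "k - l"] zdvd_imp_le[of "int N" "l - k"]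
      by (smt (verit) atLeastLessThan_iff dvd_minus_iff minus_diff_eq)
  qed
  then show "card ((\<lambda>k. w powi k) ` {0..<int N}) = card {z::complex. z ^ N = 1}"
    using card_roots_unity_eq[OF N] by (simp add: card_image)
qed

section \<open>Real solutions and solutions in roots of unity\<close>

lemma no_small_torsion_of_real:
  fixes a :: real
  assumes "1 < a"
  shows "no_small_torsion B (complex_of_real a)"
proof -
  have "complex_of_real a powi k \<noteq> 1" if "k \<noteq> 0" for k
  proof
    assume "complex_of_real a powi k = 1"
    then have "a powi k = 1"
      by (metis of_real_1 of_real_eq_iff of_real_power_int)
    then have "a ^ nat \<bar>k\<bar> = 1"
      by (auto simp: power_int_def power_inverse split: if_splits)
    moreover have "1 < a ^ nat \<bar>k\<bar>"
      using assms that by (intro one_less_power) auto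
    ultimately show False by simp
  qed
  then show ?thesis
    using assms by (auto simp: no_small_torsion_def)
qed

lemma no_small_torsion_primitive_root:
  assumes "primitive_root N w" "B < int N"
  shows "no_small_torsion B w"
proof -
  have "w powi k \<noteq> 1" if "k \<noteq> 0" "\<bar>k\<bar> \<le> B" for k
    using assms that dvd_imp_le_int[of k "int N"] by (auto simp: primitive_root_def)
  then show ?thesis
    using assms(1) by (simp add: no_small_torsion_def primitive_root_def)
qed

lemma satisfies_of_real:
  "satisfies (complex_of_real a) (\<lambda>i. complex_of_real (x i)) c \<longleftrightarrow> satisfies a x c"
proof (cases c)
  case (Ratio i j k)
  have "complex_of_real a powi k * complex_of_real (x j) = complex_of_real (a powi k * x j)"
    by (simp add: of_real_power_int)
  then show ?thesis
    by (simp only: Ratio satisfies.simps of_real_eq_iff)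
qed simp

lemma extend_of_real:
  "extend (complex_of_real a) F r e (\<lambda>i. complex_of_real (x i)) = (\<lambda>i. complex_of_real (extend a F r e x i))"
  by (auto simp: extend_def of_real_power_int fun_eq_iff)

lemma aff_dim_real_solutions:
  fixes a :: real and F :: "'n::finite set"
  assumes S: "solved_by B J F r e" and a: "1 < a"
  shows "aff_dim {x :: real ^ 'n. \<forall>c\<in>J. satisfies a (($) x) c} = int (card F)"
proof -
  have "(\<forall>c\<in>J. satisfies a x c) \<longleftrightarrow> x = extend a F r e x" for x :: "'n \<Rightarrow> real"
  proof -
    have "(\<forall>c\<in>J. satisfies a x c) \<longleftrightarrow> (\<forall>c\<in>J. satisfies (complex_of_real a) (\<lambda>i. complex_of_real (x i)) c)"
      by (simp only: satisfies_of_real)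
    also have "\<dots> \<longleftrightarrow> (\<lambda>i. complex_of_real (x i)) = (\<lambda>i. complex_of_real (extend a F r e x i))"
      using S no_small_torsion_of_real[OF a] unfolding solved_by_def extend_of_real[symmetric] by blast
    also have "\<dots> \<longleftrightarrow> x = extend a F r e x"
      by (simp only: fun_eq_iff of_real_eq_iff)
    finally show ?thesis .
  qed
  then show ?thesis
    using aff_dim_solutions[of F r e a] S by (simp add: solved_by_def)
qed

lemma card_root_of_unity_solutions:
  fixes w :: complex and F :: "'n::finite set"
  assumes S: "solved_by B J F r e" and N: "B < int N" "0 < N" and w: "primitive_root N w"
  shows "card {x. range x \<subseteq> insert 0 {z. z ^ N = 1} \<and> (\<forall>c\<in>J. satisfies w x c)} = (N + 1) ^ card F"
proof -
  let ?S = "insert 0 {z::complex. z ^ N = 1}"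
  have "finite {z::complex. z ^ N = 1}"
    using N by (intro finite_roots_unity) simp
  then have fin: "finite ?S" and card: "card ?S = N + 1"
    using N by (auto simp: card_insert_if card_roots_unity_eq power_0_left)
  have "(w powi k * s) ^ N = 1" if "s ^ N = 1" for s k
    using that primitive_root_powi_power[OF w] by (simp add: power_mult_distrib)
  then have closed: "w powi k * s \<in> ?S" if "s \<in> ?S" for s k
    using that by auto
  have "{x. range x \<subseteq> ?S \<and> (\<forall>c\<in>J. satisfies w x c)} = {x. range x \<subseteq> ?S \<and> x = extend w F r e x}"
    using S no_small_torsion_primitive_root[OF w N(1)] unfolding solved_by_def by blast
  also have "card \<dots> = card ?S ^ card F"
    using S closed fin by (intro card_solutions) (simp_all add: solved_by_def)
  finally show ?thesis
    by (simp only: card)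
qed

text \<open>
  The set \<open>{0} \<union> {z. z ^ N = 1}\<close> plays the part of a field with \<open>N + 1\<close> elements. How large \<open>N\<close> has
  to be depends on the exponents met when \<open>J\<close> is solved.
\<close>
lemma eventually_card_solutions:
  fixes a :: real and J :: "'n::finite equation set"
  assumes "finite J" "1 < a"
  shows "\<forall>\<^sub>F N in sequentially. \<forall>w. primitive_root N w \<longrightarrow>
    card {x. range x \<subseteq> insert 0 {z::complex. z ^ N = 1} \<and> (\<forall>c\<in>J. satisfies w x c)} =
      (N + 1) ^ nat (aff_dim {x :: real ^ 'n. \<forall>c\<in>J. satisfies a (($) x) c})"
proof -
  obtain B F r e where S: "solved_by B J F r e"
    using ex_solved_by[OF assms(1)] by blast
  show ?thesis
    using eventually_gt_at_top[of "nat \<bar>B\<bar>"]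
  proof eventually_elim
    case (elim N)
    then have "B < int N" "0 < N" by linarith+
    then show ?case
      using card_root_of_unity_solutions[OF S] aff_dim_real_solutions[OF S assms(2)] by simp
  qed
qed

section \<open>Separated placements of labelled points in an interval\<close>

text \<open>Packing: the blocks of length \<open>m + 1\<close> that start at the elements of \<open>S\<close> are disjoint.\<close>
lemma card_separated_le:
  fixes S :: "int set"
  assumes "finite S" "0 \<le> m" "l \<le> u"
    and sep: "\<And>s t. s \<in> S \<Longrightarrow> t \<in> S \<Longrightarrow> s < t \<Longrightarrow> s + m < t"
    and bounds: "\<And>s. s \<in> S \<Longrightarrow> l \<le> s \<and> s + m < u"
  shows "(m + 1) * int (card S) \<le> u - l"
proof -
  have "card (\<Union>s\<in>S. {s..s + m}) = (\<Sum>s\<in>S. card {s..s + m})"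
  proof (rule card_UN_disjoint[OF \<open>finite S\<close>])
    show "\<forall>s\<in>S. \<forall>t\<in>S. s \<noteq> t \<longrightarrow> {s..s + m} \<inter> {t..t + m} = {}"
    proof (intro ballI impI)
      fix s t assume "s \<in> S" "t \<in> S" "s \<noteq> t"
      then have "s + m < t \<or> t + m < s"
        using sep[of s t] sep[of t s] by linarith
      then show "{s..s + m} \<inter> {t..t + m} = {}" by auto
    qed
  qed simp
  also have "\<dots> = card S * nat (m + 1)"
    by simp
  finally have "card S * nat (m + 1) \<le> card {l..<u}"
    using bounds card_mono[of "{l..<u}" "\<Union>s\<in>S. {s..s + m}"] by fastforce
  then have "int (card S * nat (m + 1)) \<le> int (card {l..<u})"
    by (simp only: of_nat_le_iff)
  then show ?thesis
    using assms(2,3) by (simp add: mult.commute)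
qed

definition num_below :: "'v set \<Rightarrow> ('v \<Rightarrow> int) \<Rightarrow> 'v \<Rightarrow> nat" where
  "num_below A y i = card {j\<in>A. y j < y i}"

definition separated :: "int \<Rightarrow> 'v set \<Rightarrow> ('v \<Rightarrow> int) \<Rightarrow> bool" where
  "separated m A y \<longleftrightarrow> (\<forall>i\<in>A. \<forall>j\<in>A. i \<noteq> j \<longrightarrow> \<bar>y i - y j\<bar> > m)"

lemma separated_mono: "separated m A y \<Longrightarrow> B \<subseteq> A \<Longrightarrow> separated m B y"
  by (auto simp: separated_def)

lemma separated_inj_on: "separated m A y \<Longrightarrow> 0 \<le> m \<Longrightarrow> inj_on y A"
  by (force simp: separated_def inj_on_def)

lemma card_separated_values_le:
  assumes "finite B" "0 \<le> m" "l \<le> u" "separated m B y"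
    and bounds: "\<And>i. i \<in> B \<Longrightarrow> l \<le> y i \<and> y i + m < u"
  shows "(m + 1) * int (card B) \<le> u - l"
proof -
  have "(m + 1) * int (card (y ` B)) \<le> u - l"
  proof (rule card_separated_le)
    fix s t assume "s \<in> y ` B" "t \<in> y ` B" "s < t"
    then show "s + m < t"
      using \<open>separated m B y\<close> unfolding separated_def by (smt (verit) imageE)
  qed (use assms in auto)
  then show ?thesis
    using separated_inj_on[OF assms(4,2)] by (simp add: card_image)
qed

lemma num_below_diff:
  assumes "finite A" "y i \<le> y j"
  shows "num_below A y j = num_below A y i + card {k\<in>A. y i \<le> y k \<and> y k < y j}"
proof -
  have "{k\<in>A. y k < y j} = {k\<in>A. y k < y i} \<union> {k\<in>A. y i \<le> y k \<and> y k < y j}"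
    using assms(2) by auto
  then show ?thesis
    unfolding num_below_def using assms(1) by (simp add: card_Un_disjoint disjoint_iff)
qed

lemma num_below_less:
  assumes "finite A" "i \<in> A" "y i < y j"
  shows "num_below A y i < num_below A y j"
proof -
  have "0 < card {k\<in>A. y i \<le> y k \<and> y k < y j}"
    using assms by (auto simp: card_gt_0_iff)
  then show ?thesis
    using num_below_diff[of A y i j] assms by simp
qed

lemma num_below_le: "finite A \<Longrightarrow> i \<in> A \<Longrightarrow> num_below A y i \<le> card A - 1"
proof -
  assume "finite A" "i \<in> A"
  then have "num_below A y i \<le> card (A - {i})"
    unfolding num_below_def by (intro card_mono) auto
  with \<open>i \<in> A\<close> show ?thesis by simp
qed

lemma num_below_cong:
  assumes "\<And>j. j \<in> A \<Longrightarrow> z j < z i \<longleftrightarrow> y j < y i"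
  shows "num_below A z i = num_below A y i"
proof -
  have "{j\<in>A. z j < z i} = {j\<in>A. y j < y i}"
    using assms by blast
  then show ?thesis by (simp only: num_below_def)
qed

lemma separatedD:
  "separated m A y \<Longrightarrow> i \<in> A \<Longrightarrow> j \<in> A \<Longrightarrow> y i < y j \<Longrightarrow> y i + m < y j"
  unfolding separated_def by fastforce

text \<open>
  Between \<open>y i\<close> and \<open>y j\<close> there is room for the blocks of all markers from \<open>i\<close> up to, but not
  including, \<open>j\<close>.
\<close>
lemma num_below_gap:
  assumes "finite A" "0 \<le> m" "separated m A y" "y i \<le> y j" "j \<in> A"
  shows "(m + 1) * (int (num_below A y j) - int (num_below A y i)) \<le> y j - y i"
proof -
  have sep: "separated m {k\<in>A. y i \<le> y k \<and> y k < y j} y"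
    using assms(3) by (rule separated_mono) auto
  have bounds: "y i \<le> y k \<and> y k + m < y j" if "k \<in> {k\<in>A. y i \<le> y k \<and> y k < y j}" for k
    using that separatedD[OF assms(3) _ assms(5), of k] by simp
  have "(m + 1) * int (card {k\<in>A. y i \<le> y k \<and> y k < y j}) \<le> y j - y i"
    using assms(1) by (intro card_separated_values_le[OF _ assms(2,4) sep bounds]) simp_all
  then show ?thesis
    using num_below_diff[of A y i j] assms by simp
qed

text \<open>
  For positive \<open>m\<close> this takes out \<open>m\<close> positions for each marker to the left; for negative \<open>m\<close> it
  puts positions in. The two operations are inverse to each other because neither changes the
  order of the markers.
\<close>
definition compress :: "int \<Rightarrow> 'v set \<Rightarrow> ('v \<Rightarrow> int) \<Rightarrow> 'v \<Rightarrow> int" where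
  "compress m A y = restrict (\<lambda>i. y i - m * int (num_below A y i)) A"

lemma compress_less_iff:
  assumes "finite A" "i \<in> A" "j \<in> A" and m: "0 \<le> m \<and> separated m A y \<or> m \<le> 0"
  shows "compress m A y i < compress m A y j \<longleftrightarrow> y i < y j"
proof -
  have less: "y k - m * int (num_below A y k) < y l - m * int (num_below A y l)"
    if "k \<in> A" "l \<in> A" "y k < y l" for k l
    using m
  proof
    assume m: "0 \<le> m \<and> separated m A y"
    have "int (num_below A y k) < int (num_below A y l)"
      using num_below_less[of A k y l] that assms(1) by simp
    moreover have "(m + 1) * (int (num_below A y l) - int (num_below A y k)) \<le> y l - y k"
      using num_below_gap[of A m y k l] that m assms(1) by simp
    ultimately show ?thesis by (simp add: algebra_simps)
  next
    assume "m \<le> 0"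
    moreover have "int (num_below A y k) \<le> int (num_below A y l)"
      using num_below_less[of A k y l] that assms(1) by simp
    ultimately have "m * int (num_below A y l) \<le> m * int (num_below A y k)"
      by (simp add: mult_left_mono_neg)
    with that show ?thesis by simp
  qed
  have "y i - m * int (num_below A y i) = y j - m * int (num_below A y j)" if "y i = y j"
    using that by (simp add: num_below_def)
  moreover have "compress m A y i = y i - m * int (num_below A y i)" "compress m A y j = y j - m * int (num_below A y j)"
    using assms(2,3) by (simp_all add: compress_def)
  ultimately show ?thesis
    using less[OF assms(2,3)] less[OF assms(3,2)] by linarith
qed

lemma compress_compress:
  assumes "finite A" and m: "0 \<le> m \<and> separated m A y \<or> m \<le> 0" and ext: "y \<in> extensional A"
  shows "compress (- m) A (compress m A y) = y"
proof
  fix i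
  have "num_below A (compress m A y) i = num_below A y i" if "i \<in> A"
    using compress_less_iff[OF assms(1) _ that m] by (rule num_below_cong)
  then show "compress (- m) A (compress m A y) i = y i"
    using ext by (cases "i \<in> A") (simp_all add: compress_def extensional_def)
qed

lemma compress_separated_in:
  assumes "finite A" "0 \<le> m" "separated m A y" "y \<in> A \<rightarrow>\<^sub>E {l..u}"
  shows "compress m A y \<in> A \<rightarrow>\<^sub>E {l..u - m * int (card A - 1)}"
proof -
  have "y i - m * int (num_below A y i) \<in> {l..u - m * int (card A - 1)}" if i: "i \<in> A" for i
  proof -
    have iv: "l \<le> y j \<and> y j \<le> u" if "j \<in> A" for j
      using that assms(4) by auto
    have sep: "separated m {j\<in>A. y j < y i} y"
      using assms(3) by (rule separated_mono) auto
    have bounds: "l \<le> y j \<and> y j + m < y i" if "j \<in> {j\<in>A. y j < y i}" for j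
      using that iv[of j] separatedD[OF assms(3) _ i, of j] by simp
    have "(m + 1) * int (card {j\<in>A. y j < y i}) \<le> y i - l"
      using assms(1) iv[OF i] by (intro card_separated_values_le[OF _ assms(2) _ sep bounds]) simp_all
    then have lower: "(m + 1) * int (num_below A y i) \<le> y i - l"
      by (simp add: num_below_def)
    have sep': "separated m {j\<in>A. y i \<le> y j} y"
      using assms(3) by (rule separated_mono) auto
    have bounds': "y i \<le> y j \<and> y j + m < u + m + 1" if "j \<in> {j\<in>A. y i \<le> y j}" for j
      using that iv[of j] by simp
    have "(m + 1) * int (card {j\<in>A. y i \<le> y j}) \<le> (u + m + 1) - y i"
      using assms(1,2) iv[OF i] by (intro card_separated_values_le[OF _ assms(2) _ sep' bounds']) simp_all
    moreover have "card A = num_below A y i + card {j\<in>A. y i \<le> y j}"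
      unfolding num_below_def using assms(1)
      by (subst card_Un_disjoint[symmetric]) (auto intro!: arg_cong[where f=card])
    moreover have "card A \<ge> 1"
      using i assms(1) by (auto simp: Suc_le_eq card_gt_0_iff)
    ultimately have "(m + 1) * (int (card A - 1) - int (num_below A y i) + 1) \<le> (u + m + 1) - y i"
      by (simp add: of_nat_diff)
    moreover have "int (num_below A y i) \<le> int (card A - 1)"
      using num_below_le[OF assms(1) i, of y] by simp
    ultimately show ?thesis
      using lower by (auto simp: algebra_simps)
  qed
  then show ?thesis
    by (simp add: compress_def)
qed

lemma expand_in:
  assumes "finite A" "0 \<le> m" "inj_on y A" "y \<in> A \<rightarrow>\<^sub>E {l..u - m * int (card A - 1)}"
  shows "compress (- m) A y \<in> A \<rightarrow>\<^sub>E {l..u}" and "separated m A (compress (- m) A y)"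
proof -
  have "y i + m * int (num_below A y i) \<in> {l..u}" if i: "i \<in> A" for i
  proof -
    have "m * int (num_below A y i) \<le> m * int (card A - 1)"
      using num_below_le[OF assms(1) i, of y] assms(2) by (intro mult_left_mono) auto
    moreover have "0 \<le> m * int (num_below A y i)"
      using assms(2) by simp
    moreover have "y i \<in> {l..u - m * int (card A - 1)}"
      using i assms(4) by auto
    ultimately show ?thesis by auto
  qed
  then show "compress (- m) A y \<in> A \<rightarrow>\<^sub>E {l..u}"
    by (simp add: compress_def)
  have gap: "y i + m * int (num_below A y i) + m < y j + m * int (num_below A y j)"
    if "i \<in> A" "y i < y j" for i j
  proof -
    have "int (num_below A y i) + 1 \<le> int (num_below A y j)"
      using num_below_less[OF assms(1) that] by simp
    then have "m * (int (num_below A y i) + 1) \<le> m * int (num_below A y j)"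
      using assms(2) by (rule mult_left_mono)
    with that(2) show ?thesis by (simp add: algebra_simps)
  qed
  show "separated m A (compress (- m) A y)"
    unfolding separated_def
  proof (intro ballI impI)
    fix i j assume "i \<in> A" "j \<in> A" "i \<noteq> j"
    moreover from this have "y i \<noteq> y j"
      using assms(3) by (auto simp: inj_on_def)
    ultimately show "\<bar>compress (- m) A y i - compress (- m) A y j\<bar> > m"
      using gap[of i j] gap[of j i] by (simp add: compress_def) linarith
  qed
qed

text \<open>
  Compression turns separated placements into injective ones in an interval that is shorter by \<open>m\<close>
  for each of the \<open>card A - 1\<close> gaps.
\<close>
lemma card_separated:
  assumes "finite A" "0 \<le> m"
  shows "card {y \<in> A \<rightarrow>\<^sub>E {l..u}. separated m A y} =
    (\<Prod>i<card A. nat (u - m * int (card A - 1) - l + 1) - i)"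
proof -
  let ?I = "{l..u - m * int (card A - 1)}"
  have "bij_betw (compress m A) {y \<in> A \<rightarrow>\<^sub>E {l..u}. separated m A y} {y \<in> A \<rightarrow>\<^sub>E ?I. inj_on y A}"
  proof (rule bij_betw_byWitness[where f'="compress (- m) A"])
    show "\<forall>y\<in>{y \<in> A \<rightarrow>\<^sub>E {l..u}. separated m A y}. compress (- m) A (compress m A y) = y"
      using compress_compress[OF assms(1)] assms(2) by (auto simp: PiE_def)
    show "\<forall>y\<in>{y \<in> A \<rightarrow>\<^sub>E ?I. inj_on y A}. compress m A (compress (- m) A y) = y"
      using compress_compress[OF assms(1), of "- m"] assms(2) by (auto simp: PiE_def)
    show "compress m A ` {y \<in> A \<rightarrow>\<^sub>E {l..u}. separated m A y} \<subseteq> {y \<in> A \<rightarrow>\<^sub>E ?I. inj_on y A}"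
    proof (rule image_subsetI)
      fix y assume y: "y \<in> {y \<in> A \<rightarrow>\<^sub>E {l..u}. separated m A y}"
      have "inj_on (compress m A y) A"
      proof (rule inj_onI)
        fix i j assume ij: "i \<in> A" "j \<in> A" and eq: "compress m A y i = compress m A y j"
        then have "\<not> y i < y j" "\<not> y j < y i"
          using compress_less_iff[of A i j m y] compress_less_iff[of A j i m y] assms y by auto
        then have "y i = y j" by simp
        then show "i = j"
          using separated_inj_on[of m A y] assms y ij by (auto simp: inj_on_def)
      qed
      then show "compress m A y \<in> {y \<in> A \<rightarrow>\<^sub>E ?I. inj_on y A}"
        using compress_separated_in[OF assms] y by blast
    qed
    show "compress (- m) A ` {y \<in> A \<rightarrow>\<^sub>E ?I. inj_on y A} \<subseteq> {y \<in> A \<rightarrow>\<^sub>E {l..u}. separated m A y}"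
      using expand_in[OF assms] by blast
  qed
  then have "card {y \<in> A \<rightarrow>\<^sub>E {l..u}. separated m A y} = card {y \<in> A \<rightarrow>\<^sub>E ?I. inj_on y A}"
    by (rule bij_betw_same_card)
  also have "\<dots> = (\<Prod>i<card A. nat (u - m * int (card A - 1) - l + 1) - i)"
    using card_inj_on_subset_funcset[of A ?I A] assms(1) by (simp add: atLeast0LessThan)
  finally show ?thesis .
qed

section \<open>Points of the complement with coordinates in roots of unity\<close>

text \<open>
  \<open>d\<close> is the difference of two positions numbered from \<open>0\<close> to \<open>N - 1\<close> on a circle. They are close
  if one is reached from the other in at most \<open>m\<close> steps along either of the two arcs.
\<close>
lemma avoids_residues_iff:
  fixes d m N :: int
  assumes "\<bar>d\<bar> < N" "0 \<le> m"
  shows "(\<forall>k. \<bar>k\<bar> \<le> m \<longrightarrow> \<not> N dvd d - k) \<longleftrightarrow> m < \<bar>d\<bar> \<and> \<bar>d\<bar> < N - m"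
proof
  assume L: "\<forall>k. \<bar>k\<bar> \<le> m \<longrightarrow> \<not> N dvd d - k"
  have "\<not> \<bar>d\<bar> \<le> m" "\<not> \<bar>d - N\<bar> \<le> m" "\<not> \<bar>d + N\<bar> \<le> m"
    using L[rule_format, of d] L[rule_format, of "d - N"] L[rule_format, of "d + N"] by auto
  then show "m < \<bar>d\<bar> \<and> \<bar>d\<bar> < N - m"
    using assms by linarith
next
  assume R: "m < \<bar>d\<bar> \<and> \<bar>d\<bar> < N - m"
  show "\<forall>k. \<bar>k\<bar> \<le> m \<longrightarrow> \<not> N dvd d - k"
  proof (intro allI impI notI)
    fix k assume "\<bar>k\<bar> \<le> m" "N dvd d - k"
    moreover from this have "d - k \<noteq> 0" "\<bar>d - k\<bar> < N"
      using R by linarith+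
    ultimately show False
      using dvd_imp_le_int[of "d - k" N] R by linarith
  qed
qed

definition arrangement_equations :: "nat \<Rightarrow> 'n::linorder equation set" where
  "arrangement_equations m = range Vanish \<union> {Ratio i j k | i j k. i < j \<and> \<bar>k\<bar> \<le> int m}"

text \<open>
  Exchanging \<open>i\<close> and \<open>j\<close> replaces \<open>k\<close> by \<open>- k\<close>, so the restriction to \<open>i < j\<close> can be dropped.
\<close>
lemma avoids_arrangement_equations_iff:
  fixes x :: "'n::linorder \<Rightarrow> 'f::field"
  assumes "w \<noteq> 0"
  shows "(\<forall>c\<in>arrangement_equations m. \<not> satisfies w x c) \<longleftrightarrow>
    (\<forall>i. x i \<noteq> 0) \<and> (\<forall>i j k. i \<noteq> j \<longrightarrow> \<bar>k\<bar> \<le> int m \<longrightarrow> x i \<noteq> w powi k * x j)"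
    (is "?L \<longleftrightarrow> ?nz \<and> ?R")
proof
  assume L: ?L
  have less: "x i \<noteq> w powi k * x j" if "i < j" "\<bar>k\<bar> \<le> int m" for i j k
  proof -
    have "Ratio i j k \<in> arrangement_equations m"
      using that by (simp add: arrangement_equations_def)
    with L have "\<not> satisfies w x (Ratio i j k)" by blast
    then show ?thesis by simp
  qed
  have "x i \<noteq> 0" for i
  proof -
    have "Vanish i \<in> arrangement_equations m"
      by (simp add: arrangement_equations_def)
    with L have "\<not> satisfies w x (Vanish i)" by blast
    then show ?thesis by simp
  qed
  moreover have "x i \<noteq> w powi k * x j" if "i \<noteq> j" "\<bar>k\<bar> \<le> int m" for i j k
  proof (cases "i < j")
    case False
    with that have "x j \<noteq> w powi (- k) * x i"
      by (intro less) auto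
    then show ?thesis
      using assms by (auto simp: power_int_minus field_simps)
  qed (use less that in blast)
  ultimately show "?nz \<and> ?R" by blast
next
  assume "?nz \<and> ?R"
  then show ?L
    by (auto simp: arrangement_equations_def)
qed

text \<open>
  Such a point has nonzero coordinates. Dividing by the coordinate \<open>b\<close>, which can be any of the
  \<open>N\<close> roots of unity, leaves one marker at position \<open>0\<close> and the others at least \<open>m + 1\<close> steps
  away from it, hence between the positions \<open>m + 1\<close> and \<open>N - m - 1\<close>. Two of these differ by less
  than \<open>N - m\<close>, so on the arc through \<open>0\<close> they are always far enough apart, and the condition
  becomes separation in the interval.
\<close>
lemma card_avoiding_root_of_unity_points:
  fixes w :: complex
  assumes w: "primitive_root N w" and N: "0 < N"
  defines "n \<equiv> CARD('n::{finite,linorder})"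
  shows "card {x :: 'n \<Rightarrow> complex. range x \<subseteq> insert 0 {z. z ^ N = 1} \<and> (\<forall>c\<in>arrangement_equations m. \<not> satisfies w x c)}
    = N * (\<Prod>i<n - 1. nat (int N - int m * int n - 1) - i)"
    (is "card ?C = _")
proof -
  have w0: "w \<noteq> 0"
    using w by (simp add: primitive_root_def)
  define b :: 'n where "b = undefined"
  define A where "A = UNIV - {b}"
  define U where "U = {z::complex. z ^ N = 1}"
  define Y where "Y = {y \<in> A \<rightarrow>\<^sub>E {int m + 1..int N - int m - 1}. separated (int m) A y}"
  define point where "point u z = (\<lambda>i. u * w powi z i)" for u :: complex and z :: "'n \<Rightarrow> int"
  define based where "based y = (\<lambda>i. if i = b then 0 else y i)" for y :: "'n \<Rightarrow> int"
  define apart where "apart z \<longleftrightarrow> (\<forall>i j. i \<noteq> j \<longrightarrow> int m < \<bar>z i - z j\<bar> \<and> \<bar>z i - z j\<bar> < int N - int m)"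
    for z :: "'n \<Rightarrow> int"
  have U: "U = (\<lambda>k. w powi k) ` {0..<int N}"
    unfolding U_def using N w by (rule roots_of_unity_eq_powi)
  have U0: "u \<noteq> 0" if "u \<in> U" for u
    using that N by (auto simp: U_def power_0_left)
  have Umult: "u * w powi k \<in> U" if "u \<in> U" for u k
    using that primitive_root_powi_power[OF w] by (simp add: U_def power_mult_distrib)
  have C_iff: "x \<in> ?C \<longleftrightarrow> range x \<subseteq> U \<and> (\<forall>i j k. i \<noteq> j \<longrightarrow> \<bar>k\<bar> \<le> int m \<longrightarrow> x i \<noteq> w powi k * x j)" for x
  proof -
    have "range x \<subseteq> insert 0 U \<and> (\<forall>i. x i \<noteq> 0) \<longleftrightarrow> range x \<subseteq> U"
      unfolding image_subset_iff using U0[of 0] by (metis UNIV_I insert_iff)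
    then show ?thesis
      unfolding mem_Collect_eq avoids_arrangement_equations_iff[OF w0] U_def[symmetric] conj_assoc[symmetric]
      by (rule arg_cong2[where f="(\<and>)", OF _ refl])
  qed
  have point_C: "point u z \<in> ?C \<longleftrightarrow> apart z" if u: "u \<in> U" and z: "\<And>i. z i \<in> {0..<int N}" for u z
  proof -
    have "point u z i = w powi k * point u z j \<longleftrightarrow> int N dvd z i - z j - k" for i j k
    proof -
      have "point u z i = w powi k * point u z j \<longleftrightarrow> w powi z i = w powi (z j + k)"
        using U0[OF u] w0 by (simp add: point_def power_int_add mult_ac)
      then show ?thesis
        using primitive_root_powi_eq_iff[OF w] by (simp add: algebra_simps)
    qed
    moreover have "range (point u z) \<subseteq> U"
      using Umult[OF u] by (auto simp: point_def)
    ultimately have "point u z \<in> ?C \<longleftrightarrow> (\<forall>i j. i \<noteq> j \<longrightarrow> (\<forall>k. \<bar>k\<bar> \<le> int m \<longrightarrow> \<not> int N dvd z i - z j - k))"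
      unfolding C_iff by blast
    moreover have "(\<forall>k. \<bar>k\<bar> \<le> int m \<longrightarrow> \<not> int N dvd z i - z j - k) \<longleftrightarrow>
        int m < \<bar>z i - z j\<bar> \<and> \<bar>z i - z j\<bar> < int N - int m" for i j
      using z[of i] z[of j] by (intro avoids_residues_iff) auto
    ultimately show ?thesis
      by (simp only: apart_def)
  qed
  have Y_mem: "y i \<in> {int m + 1..int N - int m - 1}" if "y \<in> Y" "i \<noteq> b" for y i
  proof -
    have "y \<in> A \<rightarrow>\<^sub>E {int m + 1..int N - int m - 1}"
      using that(1) unfolding Y_def by blast
    moreover have "i \<in> A"
      using that(2) by (simp add: A_def)
    ultimately show ?thesis by (rule PiE_mem)
  qed
  have based_range: "based y i \<in> {0..<int N}" if "y \<in> Y" for y i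
  proof (cases "i = b")
    case False
    then show ?thesis
      using Y_mem[OF that False] by (simp add: based_def)
  qed (use N in \<open>simp add: based_def\<close>)
  have apart_based: "apart (based y)" if y: "y \<in> Y" for y
    unfolding apart_def
  proof (intro allI impI)
    fix i j :: 'n assume ij: "i \<noteq> j"
    have iv: "int m + 1 \<le> y i \<and> y i \<le> int N - int m - 1" if "i \<noteq> b" for i
      using Y_mem[OF y that] by simp
    have "separated (int m) A y"
      using y by (simp add: Y_def)
    then have "int m < \<bar>y i - y j\<bar>" if "i \<noteq> b" "j \<noteq> b"
      using that ij unfolding separated_def A_def by blast
    then show "int m < \<bar>based y i - based y j\<bar> \<and> \<bar>based y i - based y j\<bar> < int N - int m"
      using ij iv[of i] iv[of j] unfolding based_def by (cases "i = b"; cases "j = b") auto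
  qed
  have "bij_betw (\<lambda>(u, y). point u (based y)) (U \<times> Y) ?C"
    unfolding bij_betw_def
  proof
    show "inj_on (\<lambda>(u, y). point u (based y)) (U \<times> Y)"
    proof (rule inj_onI, clarify)
      fix u y u' y'
      assume u: "u \<in> U" and y: "y \<in> Y" "y' \<in> Y" and eq: "point u (based y) = point u' (based y')"
      have uu: "u = u'"
        using fun_cong[OF eq, of b] by (simp add: point_def based_def)
      have "y i = y' i" for i
      proof (cases "i = b")
        case True
        then have "i \<notin> A"
          by (simp add: A_def)
        moreover have "y \<in> A \<rightarrow>\<^sub>E {int m + 1..int N - int m - 1}" "y' \<in> A \<rightarrow>\<^sub>E {int m + 1..int N - int m - 1}"
          using y unfolding Y_def by blast+
        ultimately show ?thesis
          using PiE_arb by metis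
      next
        case False
        then have "w powi y i = w powi y' i"
          using fun_cong[OF eq, of i] U0[OF u] uu by (simp add: point_def based_def)
        then have "int N dvd y i - y' i"
          using primitive_root_powi_eq_iff[OF w] by blast
        moreover have "\<bar>y i - y' i\<bar> < int N"
          using based_range[OF y(1), of i] based_range[OF y(2), of i] False by (auto simp: based_def)
        ultimately show ?thesis
          using dvd_imp_le_int[of "y i - y' i" "int N"] by auto
      qed
      then show "u = u' \<and> y = y'"
        using uu by auto
    qed
    show "(\<lambda>(u, y). point u (based y)) ` (U \<times> Y) = ?C"
    proof (intro equalityI subsetI)
      fix x assume "x \<in> (\<lambda>(u, y). point u (based y)) ` (U \<times> Y)"
      then obtain u y where "u \<in> U" "y \<in> Y" "x = point u (based y)" by auto
      then show "x \<in> ?C"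
        using point_C based_range apart_based by simp
    next
      fix x assume x: "x \<in> ?C"
      then have xU: "x i \<in> U" for i
        unfolding C_iff by blast
      have "\<exists>k\<in>{0..<int N}. x i = x b * w powi k" for i
      proof -
        have "x i / x b \<in> U"
          using xU[of i] xU[of b] by (simp add: U_def power_divide)
        then obtain k where "k \<in> {0..<int N}" "x i / x b = w powi k"
          using U by auto
        then show ?thesis
          using U0[OF xU[of b]] by (intro bexI[of _ k]) (auto simp: field_simps)
      qed
      then obtain z where z: "\<And>i. z i \<in> {0..<int N}" and xz: "\<And>i. x i = x b * w powi z i"
        by metis
      have "int N dvd z b"
        using xz[of b] U0[OF xU[of b]] w by (simp add: primitive_root_def)
      then have zb: "z b = 0"
        using z[of b] zdvd_not_zless[of "z b" "int N"] by force
      have x_eq: "x = point (x b) z"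
        unfolding point_def using xz by (rule ext)
      have "point (x b) z \<in> ?C"
        unfolding x_eq[symmetric] by (rule x)
      then have apart: "apart z"
        unfolding point_C[OF xU z] .
      have "int m + 1 \<le> z i \<and> z i \<le> int N - int m - 1" if "i \<noteq> b" for i
        using apart[unfolded apart_def, rule_format, OF that] zb z[of i] by auto
      then have "restrict z A \<in> A \<rightarrow>\<^sub>E {int m + 1..int N - int m - 1}"
        unfolding restrict_PiE_iff A_def by simp
      moreover have "separated (int m) A (restrict z A)"
        using apart by (simp add: separated_def apart_def)
      ultimately have "restrict z A \<in> Y"
        by (simp add: Y_def)
      moreover have "based (restrict z A) = z"
        using zb by (auto simp: based_def A_def)
      ultimately show "x \<in> (\<lambda>(u, y). point u (based y)) ` (U \<times> Y)"
        using x_eq xU[of b] by (intro image_eqI[of _ _ "(x b, restrict z A)"]) (simp_all only: prod.case mem_Times_iff fst_conv snd_conv)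
    qed
  qed
  then have "card (U \<times> Y) = card ?C"
    by (rule bij_betw_same_card)
  then have "card ?C = card U * card Y"
    by (simp only: card_cartesian_product)
  moreover have "card U = N"
    unfolding U_def using N by (rule card_roots_unity_eq)
  moreover have "card Y = (\<Prod>i<n - 1. nat (int N - int m * int n - 1) - i)"
  proof -
    have cA: "card A = n - 1"
      by (simp add: A_def n_def)
    have "card Y = (\<Prod>i<card A. nat (int N - int m - 1 - int m * int (card A - 1) - (int m + 1) + 1) - i)"
      unfolding Y_def by (rule card_separated) (simp_all add: A_def)
    also have "\<dots> = (\<Prod>i<n - 1. nat (int N - int m * int n - 1) - i)"
    proof (rule prod.cong)
      fix i assume "i \<in> {..<n - 1}"
      then have "int (card A - 1) = int n - 2"
        unfolding cA by auto
      then have "int N - int m - 1 - int m * int (card A - 1) - (int m + 1) + 1 = int N - int m * int n - 1"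
        by (simp only:) (simp add: algebra_simps)
      then show "nat (int N - int m - 1 - int m * int (card A - 1) - (int m + 1) + 1) - i
          = nat (int N - int m * int n - 1) - i" by simp
    qed (simp add: cA)
    finally show ?thesis .
  qed
  ultimately show ?thesis by simp
qed

section \<open>The characteristic polynomial\<close>

lemma poly_eq_if_eventually_eq:
  fixes p q :: "int poly"
  assumes "\<forall>\<^sub>F N in sequentially. poly p (int N + 1) = poly q (int N + 1)"
  shows "p = q"
proof (rule ccontr)
  assume "p \<noteq> q"
  then have fin: "finite {t. poly (p - q) t = 0}"
    by (intro poly_roots_finite) simp
  obtain N0 where "\<And>N. N \<ge> N0 \<Longrightarrow> poly p (int N + 1) = poly q (int N + 1)"
    using assms unfolding eventually_sequentially by blast
  then have "(\<lambda>N. int N + 1) ` {N0..} \<subseteq> {t. poly (p - q) t = 0}"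
    by auto
  then have "finite ((\<lambda>N. int N + 1) ` {N0..})"
    using fin by (rule finite_subset)
  then show False
    using infinite_Ici[of N0] by (subst (asm) finite_image_iff) (auto simp: inj_on_def)
qed

lemma finite_arrangement_equations: "finite (arrangement_equations m :: 'n::{finite,linorder} equation set)"
proof -
  have "arrangement_equations m \<subseteq> range Vanish \<union> (\<lambda>(i::'n, j, k). Ratio i j k) ` (UNIV \<times> UNIV \<times> {- int m..int m})"
    by (force simp: arrangement_equations_def image_iff)
  then show ?thesis
    by (rule finite_subset) simp
qed

lemma multiplicative_arrangement_eq:
  "(multiplicative_arrangement a m :: (real ^ 'n::{finite,linorder}) set set) =
    (\<lambda>c. {x. satisfies a (($) x) c}) ` arrangement_equations m"
proof -
  have "\<bar>k\<bar> \<le> int m \<longleftrightarrow> k \<in> {- int m..int m}" for k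
    by auto
  then have "(\<lambda>c. {x :: (real, 'n) vec. satisfies a (($) x) c}) ` {Ratio i j k | i j k. i < j \<and> \<bar>k\<bar> \<le> int m}
      = {{x. x $ i = a powi k * x $ j} | i j k. k \<in> {- int m..int m} \<and> i < j}"
    by (simp only: setcompr_eq_image) (force simp: image_iff)
  moreover have "(\<lambda>c. {x :: (real, 'n) vec. satisfies a (($) x) c}) ` range Vanish = {{x. x $ i = 0} | i. True}"
    unfolding image_image satisfies.simps by blast
  ultimately show ?thesis
    by (simp only: multiplicative_arrangement_def arrangement_equations_def image_Un)
qed

theorem proposition2p7:
  fixes a :: real and m :: nat
  assumes "1 \<le> m" and "1 < a"
  shows "characteristic_polynomial
      (multiplicative_arrangement a m :: (real ^ 'n::{finite,linorder}) set set) =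
    [:- 1, 1:] * (\<Prod>i = 2..CARD('n). [:- int (m * CARD('n) + i), 1:])"
proof (rule poly_eq_if_eventually_eq)
  let ?I = "arrangement_equations m :: 'n equation set"
  define H where "H c = {x :: (real, 'n) vec. satisfies a (($) x) c}" for c
  \<comment> \<open>A unit vector violates each equation; for a ratio this uses that the two coordinates differ.\<close>
  have proper: "H c \<noteq> UNIV" if "c \<in> ?I" for c
  proof -
    obtain i j k where "c = Vanish i \<or> c = Ratio i j k \<and> i \<noteq> j"
      using \<open>c \<in> ?I\<close> by (auto simp: arrangement_equations_def)
    then have "axis i 1 \<notin> H c"
      by (auto simp: H_def axis_def)
    then show ?thesis by blast
  qed
  have zero: "0 \<in> H c" for c
    by (cases c) (simp_all add: H_def)
  have inter: "(\<Inter>c\<in>J. H c) = {x. \<forall>c\<in>J. satisfies a (($) x) c}" for J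
    by (auto simp: H_def)
  have "characteristic_polynomial (H ` ?I) =
      (\<Sum>J\<in>Pow ?I. monom ((- 1) ^ card J) (nat (aff_dim (\<Inter>c\<in>J. H c))))"
    using finite_arrangement_equations zero proper by (rule characteristic_polynomial_Whitney)
  then have char: "characteristic_polynomial (multiplicative_arrangement a m :: ((real, 'n) vec) set set) =
      (\<Sum>J\<in>Pow ?I. monom ((- 1) ^ card J) (nat (aff_dim {x :: (real, 'n) vec. \<forall>c\<in>J. satisfies a (($) x) c})))"
    by (simp only: multiplicative_arrangement_eq H_def[symmetric] inter)
  have "\<forall>\<^sub>F N in sequentially. \<forall>J\<in>Pow ?I. \<forall>w. primitive_root N w \<longrightarrow>
      card {x. range x \<subseteq> insert 0 {z::complex. z ^ N = 1} \<and> (\<forall>c\<in>J. satisfies w x c)} =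
      (N + 1) ^ nat (aff_dim {x :: (real, 'n) vec. \<forall>c\<in>J. satisfies a (($) x) c})"
    using assms(2) finite_subset[OF _ finite_arrangement_equations]
    by (intro eventually_ball_finite ballI eventually_card_solutions) (auto simp: finite_arrangement_equations)
  then show "\<forall>\<^sub>F N in sequentially.
      poly (characteristic_polynomial (multiplicative_arrangement a m :: ((real, 'n) vec) set set)) (int N + 1) =
      poly ([:- 1, 1:] * (\<Prod>i = 2..CARD('n). [:- int (m * CARD('n) + i), 1:])) (int N + 1)"
    using eventually_ge_at_top[of "(m + 1) * CARD('n)"]
  proof eventually_elim
    case (elim N)
    have "0 < (m + 1) * CARD('n)" by simp
    with elim(2) have N: "0 < N" by linarith
    then obtain w :: complex where w: "primitive_root N w"
      using ex_primitive_root by blast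
    define P where "P = {x :: 'n \<Rightarrow> complex. range x \<subseteq> insert 0 {z. z ^ N = 1}}"
    have "finite {z::complex. z ^ N = 1}"
      using N by (intro finite_roots_unity) simp
    then have finP: "finite P"
      using finite_set_of_finite_funs[of "UNIV :: 'n set" "insert 0 {z::complex. z ^ N = 1}"]
      by (simp add: P_def image_subset_iff)
    have "poly (characteristic_polynomial (multiplicative_arrangement a m :: ((real, 'n) vec) set set)) (int N + 1)
        = (\<Sum>J\<in>Pow ?I. (- 1) ^ card J * int (card {x\<in>P. \<forall>c\<in>J. satisfies w x c}))"
      unfolding char poly_sum poly_monom
    proof (rule sum.cong[OF refl])
      fix J assume "J \<in> Pow ?I"
      with elim(1) w have "card {x\<in>P. \<forall>c\<in>J. satisfies w x c} =
          (N + 1) ^ nat (aff_dim {x :: (real, 'n) vec. \<forall>c\<in>J. satisfies a (($) x) c})"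
        unfolding P_def mem_Collect_eq by blast
      then show "(- 1) ^ card J * (int N + 1) ^ nat (aff_dim {x :: (real, 'n) vec. \<forall>c\<in>J. satisfies a (($) x) c})
          = (- 1) ^ card J * int (card {x\<in>P. \<forall>c\<in>J. satisfies w x c})"
        by (simp add: add.commute)
    qed
    also have "\<dots> = int (card {x\<in>P. \<forall>c\<in>?I. \<not> satisfies w x c})"
      using finP finite_arrangement_equations by (rule card_avoiding_all[symmetric])
    also have "\<dots> = int (N * (\<Prod>i<CARD('n) - 1. nat (int N - int m * int CARD('n) - 1) - i))"
      using card_avoiding_root_of_unity_points[OF w N, where 'n='n, of m] by (simp add: P_def)
    also have "\<dots> = int N * (\<Prod>i<CARD('n) - 1. int N - int m * int CARD('n) - 1 - int i)"
    proof -
      have "int (nat (int N - int m * int CARD('n) - 1) - i) = int N - int m * int CARD('n) - 1 - int i"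
        if "i \<in> {..<CARD('n) - 1}" for i
      proof -
        have "int ((m + 1) * CARD('n)) \<le> int N"
          using elim(2) by (simp only: of_nat_le_iff)
        then have "int m * int CARD('n) + int CARD('n) \<le> int N"
          by (simp add: algebra_simps)
        moreover have "int i + 1 < int CARD('n)"
          using that by auto
        ultimately show ?thesis by linarith
      qed
      then have "(\<Prod>i<CARD('n) - 1. int (nat (int N - int m * int CARD('n) - 1) - i)) =
          (\<Prod>i<CARD('n) - 1. int N - int m * int CARD('n) - 1 - int i)"
        by (rule prod.cong[OF refl])
      then show ?thesis
        by (simp only: of_nat_mult of_nat_prod)
    qed
    also have "(\<Prod>i<CARD('n) - 1. int N - int m * int CARD('n) - 1 - int i) =
        (\<Prod>i = 2..CARD('n). (int N + 1) - int (m * CARD('n) + i))"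
      by (rule prod.reindex_bij_witness[of _ "\<lambda>i. i - 2" "\<lambda>i. i + 2"]) auto
    also have "int N * \<dots> = poly ([:- 1, 1:] * (\<Prod>i = 2..CARD('n). [:- int (m * CARD('n) + i), 1:])) (int N + 1)"
      by (simp add: poly_prod algebra_simps)
    finally show ?case .
  qed
qed

end
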